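(* Let $J,R,Q,E\in\mathbb{R}^{n\times n}$ with $J=-J^\top$, $R=R^\top\ge0$, $Q^\top E=E^\top Q\ge0$. The following are equivalent: (a) The pencil $P(s)=sE-(J-R)Q$ is regular. (b) $\ker(Q^\top JQ)\cap\ker(RQ)\cap\ker E=\{0\}$. (c) $\ker(Q^\top JQ)\cap\ker(RQ)\cap\ker(E^\top Q)=\ker Q$ and $\ker E\cap\ker Q=\{0\}$.
   Context: A pencil $P(s)=sE-A$ is regular if $P(\mu)$ is invertible for some $\mu\in\mathbb{C}$. *)

theory Defs
  imports "HOL-Analysis.Analysis"
begin

definition mat_kernel :: "real^'n^'m \<Rightarrow> (real^'n) set" where
  "mat_kernel A = {x. A *v x = 0}"

definition psd :: "real^'n^'n \<Rightarrow> bool" where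
  "psd A \<longleftrightarrow> transpose A = A \<and> (\<forall>x. 0 \<le> x \<bullet> (A *v x))"

definition pencil :: "complex^'n^'n \<Rightarrow> complex^'n^'n \<Rightarrow> complex \<Rightarrow> complex^'n^'n" where
  "pencil E A s = (\<chi> i j. s * E $ i $ j - A $ i $ j)"

definition regular_pencil :: "(complex \<Rightarrow> complex^'n^'n) \<Rightarrow> bool" where
  "regular_pencil P \<longleftrightarrow> (\<exists>\<mu>. invertible (P \<mu>))"

text \<open>The pencil \<open>s E - A\<close> of real matrices, with \<open>s\<close> ranging over the complex numbers.\<close>
definition real_pencil :: "real^'n^'n \<Rightarrow> real^'n^'n \<Rightarrow> complex \<Rightarrow> complex^'n^'n" where
  "real_pencil E A = pencil (map_matrix complex_of_real E) (map_matrix complex_of_real A)"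

end

theory Submission
  imports Defs
begin

text \<open>Symmetry of \<open>Q\<^sup>T E\<close> makes \<open>E\<close> map \<open>ker Q\<close> into \<open>ker Q\<^sup>T\<close>, and by a dimension count it maps
  onto as soon as \<open>ker E \<inter> ker Q = {0}\<close>. This lets one correct any vector \<open>x\<close> with \<open>Q\<^sup>T J Q x = 0\<close>
  or \<open>E\<^sup>T Q x = 0\<close> by an element of \<open>ker Q\<close>, so that \<open>J Q x\<close> or \<open>E x\<close>, respectively, is cancelled.
  For the implication from (b) to (a), a kernel vector \<open>z\<close> of \<open>E - (J - R) Q\<close> satisfies the energy
  identity \<open>z\<^sup>T Q\<^sup>T E z = - (Q z)\<^sup>T R (Q z)\<close>, so both sides vanish.\<close>

section \<open>Real linear algebra: semidefinite forms, kernels and dimensions\<close>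

text \<open>If \<open>y = A *v x\<close> were nonzero, the form at \<open>x - t *\<^sub>R y\<close>
  would be \<open>t * (t * b - 2 * a)\<close> with \<open>a > 0\<close>, which is negative for small
  positive \<open>t\<close>.\<close>

lemma psd_mult_eq_0:
  fixes A :: "real^'n^'n"
  assumes "psd A" and "x \<bullet> (A *v x) = 0"
  shows "A *v x = 0"
proof (rule ccontr)
  assume nz: "A *v x \<noteq> 0"
  define y where "y = A *v x"
  define a where "a = y \<bullet> y"
  define b where "b = y \<bullet> (A *v y)"
  \<comment> \<open>Small enough that \<open>t * b \<le> a < 2 * a\<close>; the summand 1 covers the
    case \<open>b = 0\<close>.\<close>
  define t where "t = a / (b + 1)"
  have a: "a > 0"
    using nz by (simp add: a_def y_def)
  have b: "b \<ge> 0"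
    using assms(1) by (simp add: b_def psd_def)
  have t: "t > 0"
    using a b by (simp add: t_def)
  have sym: "x \<bullet> (A *v y) = y \<bullet> y"
    using assms(1) by (metis dot_lmul_matrix psd_def transpose_matrix_vector y_def)
  have "0 \<le> (x - t *\<^sub>R y) \<bullet> (A *v (x - t *\<^sub>R y))"
    using assms(1) by (simp add: psd_def)
  also have "\<dots> = t * (t * b - 2 * a)"
    using assms(2) sym
    by (simp add: matrix_vector_mult_diff_distrib matrix_vector_mult_scaleR inner_diff_left
        inner_diff_right a_def b_def algebra_simps flip: y_def)
  finally have "2 * a \<le> t * b"
    using t by (simp add: zero_le_mult_iff)
  moreover have "t * b \<le> a"
    using a b by (simp add: t_def field_simps)
  ultimately show False
    using a by simp
qed

lemma subspace_mat_kernel: "subspace (mat_kernel A)"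
  by (auto simp: mat_kernel_def subspace_def matrix_vector_right_distrib matrix_vector_mult_scaleR)

text \<open>Rank-nullity: the kernel is the orthogonal complement of the row space, whose dimension
  is the rank.\<close>

lemma dim_mat_kernel:
  fixes A :: "real^'n^'m"
  shows "dim (mat_kernel A) + rank A = CARD('n)"
proof -
  have "mat_kernel A = {y \<in> UNIV. \<forall>x\<in>span (rows A). orthogonal x y}"
  proof (intro set_eqI iffI)
    fix y assume "y \<in> mat_kernel A"
    then show "y \<in> {y \<in> UNIV. \<forall>x\<in>span (rows A). orthogonal x y}"
      using orthogonal_nullspace_rowspace[of A y] by (auto simp: mat_kernel_def orthogonal_commute)
  next
    fix y assume "y \<in> {y \<in> UNIV. \<forall>x\<in>span (rows A). orthogonal x y}"
    then have "orthogonal (A $ i) y" for i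
      by (auto intro!: span_base simp: rows_def row_def)
    then show "y \<in> mat_kernel A"
      by (simp add: mat_kernel_def vec_eq_iff matrix_vector_mul_component orthogonal_def)
  qed
  moreover have "dim {y \<in> UNIV. \<forall>x\<in>span (rows A). orthogonal x y} + dim (span (rows A))
      = dim (UNIV :: (real^'n) set)"
    by (rule dim_subspace_orthogonal_to_vectors) auto
  ultimately show ?thesis
    by (simp add: row_rank_def)
qed

lemma dim_mat_kernel_transpose:
  fixes Q :: "real^'n^'n"
  shows "dim (mat_kernel (transpose Q)) = dim (mat_kernel Q)"
  using dim_mat_kernel[of Q] dim_mat_kernel[of "transpose Q"] by (simp add: rank_transpose)

text \<open>The first hypothesis gives one inclusion. The second makes \<open>E\<close> injective on
  the kernel of \<open>Q\<close>, which has the same dimension as the kernel of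
  \<open>transpose Q\<close>, so the inclusion is an equality.\<close>

lemma image_mat_kernel_eq_mat_kernel_transpose:
  fixes E Q :: "real^'n^'n"
  assumes "transpose Q ** E = transpose E ** Q" and "mat_kernel E \<inter> mat_kernel Q = {0}"
  shows "(*v) E ` mat_kernel Q = mat_kernel (transpose Q)"
proof (rule subspace_dim_equal)
  show "subspace ((*v) E ` mat_kernel Q)"
    by (simp add: linear_subspace_image subspace_mat_kernel)
  show "subspace (mat_kernel (transpose Q))"
    by (rule subspace_mat_kernel)
  have "transpose Q *v (E *v x) = transpose E *v (Q *v x)" for x
    by (simp only: matrix_vector_mul_assoc assms(1))
  then show "(*v) E ` mat_kernel Q \<subseteq> mat_kernel (transpose Q)"
    by (auto simp: mat_kernel_def)
  have "inj_on ((*v) E) (mat_kernel Q)"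
  proof (rule inj_onI)
    fix x y assume "x \<in> mat_kernel Q" "y \<in> mat_kernel Q" "E *v x = E *v y"
    then have "x - y \<in> mat_kernel E \<inter> mat_kernel Q"
      by (simp add: mat_kernel_def matrix_vector_mult_diff_distrib)
    then show "x = y"
      using assms(2) by simp
  qed
  then have "dim ((*v) E ` mat_kernel Q) = dim (mat_kernel Q)"
    by (intro dim_image_eq) (auto simp: span_eq_iff[THEN iffD2] subspace_mat_kernel)
  then show "dim (mat_kernel (transpose Q)) \<le> dim ((*v) E ` mat_kernel Q)"
    by (simp add: dim_mat_kernel_transpose)
qed

section \<open>Real matrices and vectors viewed over the complex numbers\<close>

definition of_real_vec :: "real^'n \<Rightarrow> complex^'n" where
  "of_real_vec x = (\<chi> i. complex_of_real (x $ i))"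

lemma of_real_vec_eq_0_iff [simp]: "of_real_vec x = 0 \<longleftrightarrow> x = 0"
  by (simp add: of_real_vec_def vec_eq_iff)

lemma of_real_vec_0 [simp]: "of_real_vec 0 = 0"
  by simp

lemma map_matrix_of_real_mult_vec:
  "map_matrix complex_of_real A *v of_real_vec x = of_real_vec (A *v x)"
  by (simp add: of_real_vec_def vec_eq_iff matrix_vector_mult_def map_matrix_def)

lemma map_matrix_of_real_mult:
  "map_matrix complex_of_real (A ** B) = map_matrix complex_of_real A ** map_matrix complex_of_real B"
  by (simp add: vec_eq_iff matrix_matrix_mult_def map_matrix_def)

lemma map_matrix_of_real_mat_1: "map_matrix complex_of_real (mat 1) = mat 1"
  by (simp add: vec_eq_iff map_matrix_def mat_def)

lemma invertible_map_matrix_of_real: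
  "invertible A \<Longrightarrow> invertible (map_matrix complex_of_real A)"
  unfolding invertible_def by (metis map_matrix_of_real_mat_1 map_matrix_of_real_mult)

lemma real_pencil_mult_vec:
  "real_pencil E A s *v y = s *s (map_matrix complex_of_real E *v y) - map_matrix complex_of_real A *v y"
  by (simp add: vec_eq_iff real_pencil_def pencil_def matrix_vector_mult_def sum_subtractf
      sum_distrib_left algebra_simps)

lemma real_pencil_1: "real_pencil E A 1 = map_matrix complex_of_real (E - A)"
  by (simp add: vec_eq_iff real_pencil_def pencil_def map_matrix_def)

text \<open>A common kernel vector of \<open>E\<close> and \<open>A\<close> is annihilated by the
  pencil at every point.\<close>

lemma regular_pencil_inter_kernel_trivial:
  fixes E A :: "real^'n^'n"
  assumes "invertible (real_pencil E A \<mu>)" and "E *v x = 0" and "A *v x = 0"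
  shows "x = 0"
proof -
  have "real_pencil E A \<mu> *v of_real_vec x = 0"
    by (simp add: real_pencil_mult_vec map_matrix_of_real_mult_vec assms)
  then show ?thesis
    using assms(1) by (metis invertible_def matrix_left_invertible_ker of_real_vec_eq_0_iff)
qed

section \<open>The three conditions and their equivalence\<close>

locale dissipative_hamiltonian =
  fixes J R Q E :: "real^'n^'n"
  assumes skew: "J = - transpose J"
    and psd_R: "psd R"
    and comm: "transpose Q ** E = transpose E ** Q"
    and psd_QE: "psd (transpose Q ** E)"
begin

lemma Q_E: "(E *v x) v* Q = (Q *v x) v* E"
  by (metis comm matrix_vector_mul_assoc transpose_matrix_vector)

lemma kernel_E_Q_subset:
  "mat_kernel E \<inter> mat_kernel Q \<subseteq> mat_kernel (transpose Q ** J ** Q) \<inter> mat_kernel (R ** Q) \<inter> mat_kernel E"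
  by (auto simp: mat_kernel_def simp flip: matrix_vector_mul_assoc)

text \<open>This is the substantial inclusion of (c); it is used again in deriving regularity from
  (b).\<close>

lemma kernel_QtJQ_RQ_EtQ_subset:
  assumes triv: "mat_kernel (transpose Q ** J ** Q) \<inter> mat_kernel (R ** Q) \<inter> mat_kernel E = {0}"
    and x: "x \<in> mat_kernel (transpose Q ** J ** Q) \<inter> mat_kernel (R ** Q) \<inter> mat_kernel (transpose E ** Q)"
  shows "x \<in> mat_kernel Q"
proof -
  have "mat_kernel E \<inter> mat_kernel Q = {0}"
    using kernel_E_Q_subset unfolding triv by (auto simp: mat_kernel_def)
  moreover have "E *v x \<in> mat_kernel (transpose Q)"
    using x by (simp add: mat_kernel_def Q_E flip: matrix_vector_mul_assoc)
  ultimately obtain v where v: "v \<in> mat_kernel Q" "E *v x = E *v v"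
    using image_mat_kernel_eq_mat_kernel_transpose[OF comm] by blast
  \<comment> \<open>Subtracting \<open>v\<close> from the kernel of \<open>Q\<close> preserves the
    first two conditions and turns the third into \<open>E *v (x - v) = 0\<close>.\<close>
  have "x - v \<in> mat_kernel (transpose Q ** J ** Q) \<inter> mat_kernel (R ** Q) \<inter> mat_kernel E"
    using x v by (simp add: mat_kernel_def matrix_vector_mult_diff_distrib flip: matrix_vector_mul_assoc)
  then have "x = v"
    unfolding triv by simp
  with v show ?thesis by simp
qed

lemma kernel_trivial_iff:
  "mat_kernel (transpose Q ** J ** Q) \<inter> mat_kernel (R ** Q) \<inter> mat_kernel E = {0} \<longleftrightarrow>
   mat_kernel (transpose Q ** J ** Q) \<inter> mat_kernel (R ** Q) \<inter> mat_kernel (transpose E ** Q)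
     = mat_kernel Q \<and> mat_kernel E \<inter> mat_kernel Q = {0}" (is "?b \<longleftrightarrow> ?c \<and> ?d")
proof
  assume b: ?b
  have "mat_kernel Q \<subseteq> mat_kernel (transpose Q ** J ** Q) \<inter> mat_kernel (R ** Q) \<inter> mat_kernel (transpose E ** Q)"
    by (auto simp: mat_kernel_def simp flip: matrix_vector_mul_assoc)
  moreover have ?d
    using kernel_E_Q_subset unfolding b by (auto simp: mat_kernel_def)
  ultimately show "?c \<and> ?d"
    using kernel_QtJQ_RQ_EtQ_subset[OF b] by blast
next
  assume cd: "?c \<and> ?d"
  \<comment> \<open>By symmetry, \<open>E *v x = 0\<close> forces
    \<open>transpose E *v (Q *v x) = 0\<close>, so (c) places the intersection in (b) inside the
    kernels of both \<open>Q\<close> and \<open>E\<close>.\<close>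
  have "mat_kernel E \<subseteq> mat_kernel (transpose E ** Q)"
    by (auto simp: mat_kernel_def Q_E[symmetric] simp flip: matrix_vector_mul_assoc)
  moreover have "0 \<in> mat_kernel (transpose Q ** J ** Q) \<inter> mat_kernel (R ** Q) \<inter> mat_kernel E"
    by (simp add: mat_kernel_def)
  ultimately show ?b
    using cd by blast
qed

lemma regular_imp_kernel_trivial:
  assumes "regular_pencil (real_pencil E ((J - R) ** Q))"
  shows "mat_kernel (transpose Q ** J ** Q) \<inter> mat_kernel (R ** Q) \<inter> mat_kernel E = {0}"
proof -
  define A where "A = (J - R) ** Q"
  have A: "A *v x = J *v (Q *v x) - R *v (Q *v x)" for x
    by (simp add: A_def matrix_vector_mult_diff_rdistrib flip: matrix_vector_mul_assoc)
  obtain \<mu> where \<mu>: "invertible (real_pencil E A \<mu>)"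
    using assms by (auto simp: regular_pencil_def A_def)
  note ker0 = regular_pencil_inter_kernel_trivial[OF \<mu>]
  have EQ: "mat_kernel E \<inter> mat_kernel Q = {0}"
    using ker0 by (auto simp: mat_kernel_def A)
  have "x = 0" if x: "transpose Q *v (J *v (Q *v x)) = 0" "R *v (Q *v x) = 0" "E *v x = 0" for x
  proof -
    have "A *v x \<in> mat_kernel (transpose Q)"
      using x by (simp add: A mat_kernel_def)
    then obtain v where v: "Q *v v = 0" "A *v x = E *v v"
      using image_mat_kernel_eq_mat_kernel_transpose[OF comm EQ] by (auto simp: mat_kernel_def)
    have Av: "A *v v = 0"
      using v by (simp add: A)
    \<comment> \<open>As \<open>E *v x = 0\<close>, \<open>A *v x = E *v v\<close> and
      \<open>A *v v = 0\<close>, the pencil at \<open>\<mu>\<close> sends this vector to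
      \<open>\<mu> *s (E *v v - A *v x) = 0\<close>.\<close>
    let ?y = "\<mu> *s of_real_vec x + of_real_vec v"
    have "real_pencil E A \<mu> *v ?y = 0"
      using x v Av
      by (simp add: real_pencil_mult_vec matrix_vector_right_distrib vector_scalar_commute
          map_matrix_of_real_mult_vec)
    then have y: "?y = 0"
      using \<mu> by (metis invertible_def matrix_left_invertible_ker)
    have "A *v x = 0"
    \<comment> \<open>For \<open>\<mu> = 0\<close> the vector \<open>?y\<close> retains only
      \<open>v\<close>, so \<open>A *v x = E *v v\<close> vanishes; otherwise applying
      \<open>Q\<close> removes \<open>v\<close> and leaves \<open>Q *v x = 0\<close>.\<close>
    proof (cases "\<mu> = 0")
      case True
      then show ?thesis
        using y v by simp
    next
      case False
      have "\<mu> *s of_real_vec (Q *v x) = map_matrix complex_of_real Q *v ?y"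
        using v by (simp add: matrix_vector_right_distrib vector_scalar_commute
            map_matrix_of_real_mult_vec)
      with y False have "Q *v x = 0"
        by simp
      then show ?thesis
        by (simp add: A)
    qed
    with x ker0 show ?thesis by blast
  qed
  then show ?thesis
    by (auto simp: mat_kernel_def simp flip: matrix_vector_mul_assoc)
qed

text \<open>The point 1 serves as witness: there the pencil is the real matrix
  \<open>E - (J - R) ** Q\<close>, so a real kernel computation suffices.\<close>

lemma kernel_trivial_imp_regular:
  assumes triv: "mat_kernel (transpose Q ** J ** Q) \<inter> mat_kernel (R ** Q) \<inter> mat_kernel E = {0}"
  shows "regular_pencil (real_pencil E ((J - R) ** Q))"
proof -
  have "z = 0" if z: "(E - (J - R) ** Q) *v z = 0" for z
  proof -
    have Ez: "E *v z = J *v (Q *v z) - R *v (Q *v z)"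
      using z by (simp add: matrix_vector_mult_diff_rdistrib flip: matrix_vector_mul_assoc)
    have "(Q *v z) \<bullet> (J *v (Q *v z)) = (transpose J *v (Q *v z)) \<bullet> (Q *v z)"
      by (simp add: dot_lmul_matrix)
    also have "transpose J *v (Q *v z) = - (J *v (Q *v z))"
      by (subst skew) (simp add: vec_eq_iff matrix_vector_mult_def sum_negf vector_matrix_mult_def transpose_def)
    finally have J0: "(Q *v z) \<bullet> (J *v (Q *v z)) = 0"
      by (simp add: inner_commute)
    have "z \<bullet> ((transpose Q ** E) *v z) = (Q *v z) \<bullet> (E *v z)"
      by (metis dot_lmul_matrix matrix_vector_mul_assoc transpose_matrix_vector transpose_transpose)
    also have "\<dots> = - ((Q *v z) \<bullet> (R *v (Q *v z)))"
      using J0 by (simp add: Ez inner_diff_right)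
    finally have "z \<bullet> ((transpose Q ** E) *v z) = - ((Q *v z) \<bullet> (R *v (Q *v z)))" .
    moreover have "0 \<le> z \<bullet> ((transpose Q ** E) *v z)" "0 \<le> (Q *v z) \<bullet> (R *v (Q *v z))"
      using psd_R psd_QE by (auto simp: psd_def)
    \<comment> \<open>Two nonnegative numbers that are negatives of each other vanish, and
      semidefiniteness turns vanishing forms into vanishing vectors.\<close>
    ultimately have R0: "R *v (Q *v z) = 0" and E0: "(transpose Q ** E) *v z = 0"
      using psd_mult_eq_0 psd_R psd_QE by auto
    \<comment> \<open>With \<open>R0\<close>, \<open>Ez\<close> reads
      \<open>E *v z = J *v (Q *v z)\<close>; multiplying by \<open>transpose Q\<close> and using
      \<open>E0\<close> gives the first membership.\<close>
    then have "z \<in> mat_kernel (transpose Q ** J ** Q) \<inter> mat_kernel (R ** Q) \<inter> mat_kernel (transpose E ** Q)"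
      using Ez by (simp add: mat_kernel_def Q_E[symmetric] flip: matrix_vector_mul_assoc)
    then have Qz: "Q *v z = 0"
      using kernel_QtJQ_RQ_EtQ_subset[OF triv] by (simp add: mat_kernel_def)
    \<comment> \<open>Now \<open>Q *v z = 0\<close> makes the right-hand side of \<open>Ez\<close>
      vanish, hence \<open>E *v z = 0\<close>.\<close>
    then have "z \<in> mat_kernel (transpose Q ** J ** Q) \<inter> mat_kernel (R ** Q) \<inter> mat_kernel E"
      using Ez by (simp add: mat_kernel_def flip: matrix_vector_mul_assoc)
    with triv show ?thesis by simp
  qed
  then have "invertible (E - (J - R) ** Q)"
    by (metis invertible_left_inverse matrix_left_invertible_ker)
  then show ?thesis
    unfolding regular_pencil_def using invertible_map_matrix_of_real by (metis real_pencil_1)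
qed

end

theorem propositionB10:
  fixes J R Q E :: "real^'n^'n"
  assumes "J = - transpose J"
    and "R = transpose R" and "psd R"
    and "transpose Q ** E = transpose E ** Q" and "psd (transpose Q ** E)"
  shows "(regular_pencil (real_pencil E ((J - R) ** Q)) \<longleftrightarrow>
          mat_kernel (transpose Q ** J ** Q) \<inter> mat_kernel (R ** Q) \<inter> mat_kernel E = {0}) \<and>
         (mat_kernel (transpose Q ** J ** Q) \<inter> mat_kernel (R ** Q) \<inter> mat_kernel E = {0} \<longleftrightarrow>
          mat_kernel (transpose Q ** J ** Q) \<inter> mat_kernel (R ** Q) \<inter> mat_kernel (transpose E ** Q)
            = mat_kernel Q \<and>
          mat_kernel E \<inter> mat_kernel Q = {0})"
proof -
  interpret dissipative_hamiltonian J R Q E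
    using assms by unfold_locales
  show ?thesis
    using regular_imp_kernel_trivial kernel_trivial_imp_regular kernel_trivial_iff by blast
qed

end
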